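(* Let $n\in\mathbb{N}$, $k\in\{1,\dots,n\}$, and let $\mu$ be a $k$-homogeneous probability measure on $\Omega=\{0,1\}^n$ with the stochastic covering property (SCP). Let $f:\Omega\to\mathcal{H}_d$ be a $1$-Lipschitz matrix function in the sense that $\|f(x)-f(y)\|\le\|x-y\|_1$ for any $x,y\in\Omega$, where $\|\cdot\|$ stands for the operator norm. Then, for any $t\in\mathbb{R}_+$, $$\mu\Big(\lambda_{\max}\big(f-\mathbb{E}_\mu f\big)\ge t\Big)\le d\,\exp\bigg(-\frac{t^2}{8k+2t\sqrt{2k}}\bigg).$$
   Context: $\mathcal{H}_d$ is the set of $d\times d$ Hermitian matrices, $\lambda_{\max}$ is the largest eigenvalue, $\|\cdot\|_1$ is the $\ell_1$-norm on $\mathbb{R}^n$, and $\mathbb{E}_\mu f$ is the entrywise expectation. $\mu$ is $k$-homogeneous if $\mathbb{P}(\sum_{i=1}^n\xi_i=k)=1$ when $\xi\sim\mu$. For a finite index set $T$ and $x,y\in\{0,1\}^T$, write $x\preceq y$ if $x=y$ or $y$ is obtained from $x$ by changing exactly one coordinate from $0$ to $1$ (the other coordinates being equal). For probability measures $\mu_1,\mu_2$ on $\{0,1\}^T$, write $\mu_1\preceq\mu_2$ if there is a coupling $\kappa$ of $\mu_1$ and $\mu_2$ whose support is contained in $\{(x,y):x\preceq y\}$. Let $\xi\sim\mu$ and for $S\subseteq\{1,\dots,n\}$ let $\xi_S$ be the restriction of $\xi$ to the coordinates in $S$. $\mu$ has the stochastic covering property if for every $S\subseteq\{1,\dots,n\}$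 and all $x_S,y_S\in\{0,1\}^S$ (with $\xi_S=x_S$ and $\xi_S=y_S$ both of positive probability), $$x_S\preceq y_S\ \Longrightarrow\ \mu(\cdot\mid\xi_S=y_S)\preceq\mu(\cdot\mid\xi_S=x_S),$$ where the conditional laws are regarded as probability measures on $\{0,1\}^{S^c}$. *)

theory Defs
  imports "HOL-Probability.Probability"
begin

text \<open>
  Points of \<open>{0,1}\<^sup>T\<close> are represented as extensional functions on \<open>T\<close>, with value
  \<^const>\<open>undefined\<close> outside \<open>T\<close>; hence two points are equal iff they agree on \<open>T\<close>.
  A probability measure on such a finite cube is a pmf whose support lies in the cube.
\<close>

definition cube :: "'a set \<Rightarrow> ('a \<Rightarrow> real) set" where
  "cube T = T \<rightarrow>\<^sub>E {0, 1}"

definition l1_dist_on :: "'a set \<Rightarrow> ('a \<Rightarrow> real) \<Rightarrow> ('a \<Rightarrow> real) \<Rightarrow> real" where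
  "l1_dist_on T x y = (\<Sum>i\<in>T. \<bar>x i - y i\<bar>)"

definition homogeneous :: "'a set \<Rightarrow> nat \<Rightarrow> ('a \<Rightarrow> real) pmf \<Rightarrow> bool" where
  "homogeneous T k \<mu> \<longleftrightarrow> measure_pmf.prob \<mu> {\<xi>. (\<Sum>i\<in>T. \<xi> i) = real k} = 1"

definition covered_by :: "'a set \<Rightarrow> ('a \<Rightarrow> real) \<Rightarrow> ('a \<Rightarrow> real) \<Rightarrow> bool" where
  "covered_by T x y \<longleftrightarrow> x \<in> cube T \<and> y \<in> cube T \<and>
     (x = y \<or> (\<exists>i\<in>T. x i = 0 \<and> y i = 1 \<and> (\<forall>j\<in>T - {i}. x j = y j)))"

definition stoch_covered_by ::
  "'a set \<Rightarrow> ('a \<Rightarrow> real) pmf \<Rightarrow> ('a \<Rightarrow> real) pmf \<Rightarrow> bool" where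
  "stoch_covered_by T \<mu>1 \<mu>2 \<longleftrightarrow>
     (\<exists>\<kappa>. map_pmf fst \<kappa> = \<mu>1 \<and> map_pmf snd \<kappa> = \<mu>2 \<and> set_pmf \<kappa> \<subseteq> {(x, y). covered_by T x y})"

text \<open>
  \<open>cond_law T \<mu> S x\<close> is the law \<open>\<mu>(\<cdot> | \<xi>\<^sub>S = x)\<close> as a measure on \<open>{0,1}\<close> to the power
  \<open>T - S\<close>. It is meaningful only if the conditioning event has positive probability
  (otherwise \<^const>\<open>cond_pmf\<close> is unspecified).
\<close>

definition cond_law ::
  "'a set \<Rightarrow> ('a \<Rightarrow> real) pmf \<Rightarrow> 'a set \<Rightarrow> ('a \<Rightarrow> real) \<Rightarrow> ('a \<Rightarrow> real) pmf" where
  "cond_law T \<mu> S x =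
     map_pmf (\<lambda>\<xi>. restrict \<xi> (T - S)) (cond_pmf \<mu> {\<xi>. restrict \<xi> S = x})"

definition stochastic_covering :: "'a set \<Rightarrow> ('a \<Rightarrow> real) pmf \<Rightarrow> bool" where
  "stochastic_covering T \<mu> \<longleftrightarrow>
     (\<forall>S x y. S \<subseteq> T \<and> x \<in> cube S \<and> y \<in> cube S \<and>
        measure_pmf.prob \<mu> {\<xi>. restrict \<xi> S = x} > 0 \<and>
        measure_pmf.prob \<mu> {\<xi>. restrict \<xi> S = y} > 0 \<and>
        covered_by S x y
        \<longrightarrow> stoch_covered_by (T - S) (cond_law T \<mu> S y) (cond_law T \<mu> S x))"

definition hermitian :: "complex^'d^'d \<Rightarrow> bool" where
  "hermitian A \<longleftrightarrow> (\<forall>i j. A $ i $ j = cnj (A $ j $ i))"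

definition mat_eigenvalue :: "complex^'d^'d \<Rightarrow> complex \<Rightarrow> bool" where
  "mat_eigenvalue A c \<longleftrightarrow> (\<exists>v. v \<noteq> 0 \<and> A *v v = c *s v)"

text \<open>
  Used for Hermitian matrices only: their eigenvalues are all real, and there are finitely
  many of them and at least one, so the maximum exists.
\<close>

definition lambda_max :: "complex^'d^'d \<Rightarrow> real" where
  "lambda_max A = Max {r. mat_eigenvalue A (complex_of_real r)}"

text \<open>The norm on \<^typ>\<open>complex^'d\<close> is the Euclidean one.\<close>

definition op_norm :: "complex^'d^'d \<Rightarrow> real" where
  "op_norm A = onorm (\<lambda>v. A *v v)"

definition mat_expectation :: "'a pmf \<Rightarrow> ('a \<Rightarrow> complex^'d^'d) \<Rightarrow> complex^'d^'d" where
  "mat_expectation \<mu> f = (\<chi> i j. measure_pmf.expectation \<mu> (\<lambda>x. f x $ i $ j))"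

end

theory Submission
  imports Defs
begin

text \<open>
  Reveal the \<open>k\<close> ones of \<open>\<xi>\<close> in uniformly random order, and consider the martingale of conditional
  expectations of \<open>f\<close> given the ones revealed so far. The stochastic covering property couples the
  laws conditioned on \<open>\<xi>\<^sub>i = 1\<close> and on \<open>\<xi>\<^sub>i = 0\<close> so that the two samples are at distance at most 2;
  hence each of the \<open>k\<close> martingale steps has norm at most 2.

  Golden--Thompson is not needed to control the trace exponential along the martingale. If \<open>u\<close> and
  \<open>v\<close> run through eigenbases of \<open>A\<close> and \<open>B\<close> with eigenvalues \<open>a\<close> and \<open>b\<close>, then the weights \<open>(u \<bullet> v)\<^sup>2\<close> are
  doubly stochastic, the weighted means of \<open>b - a\<close> and \<open>(b - a)\<^sup>2\<close> over \<open>v\<close> are \<open>u \<bullet> (B - A) u\<close> and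
  \<open>\<parallel>(B - A) u\<parallel>\<^sup>2\<close>, and symmetrically over \<open>u\<close>. Summing the scalar inequality
  \<open>exp x \<le> 1 + x + x\<^sup>2 (1/3 + exp x / 6)\<close> at \<open>x = \<theta> (b - a)\<close> thus bounds \<open>Tr exp (\<theta> B)\<close> by \<open>Tr exp (\<theta> A)\<close>,
  a term linear in \<open>B - A\<close> that vanishes in the mean, and a term of order \<open>\<theta>\<^sup>2 \<parallel>B - A\<parallel>\<^sup>2\<close>.
  This yields \<open>E Tr exp (\<theta> (f - E f)) \<le> d exp (2 k \<theta>\<^sup>2)\<close> for \<open>\<theta> \<le> 1/2\<close>, and Markov's inequality concludes.
\<close>

subsection \<open>Eigenbases of self-adjoint operators\<close>

definition selfadjoint :: "('a::euclidean_space \<Rightarrow>\<^sub>L 'a) \<Rightarrow> bool" where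
  "selfadjoint A \<longleftrightarrow> (\<forall>x y. A x \<bullet> y = x \<bullet> A y)"

lemma selfadjoint_diff: "selfadjoint A \<Longrightarrow> selfadjoint B \<Longrightarrow> selfadjoint (A - B)"
  by (simp add: selfadjoint_def blinfun.diff_left inner_simps)

lemma selfadjoint_sum: "(\<And>i. i \<in> I \<Longrightarrow> selfadjoint (A i)) \<Longrightarrow> selfadjoint (\<Sum>i\<in>I. A i)"
  by (simp add: selfadjoint_def blinfun.sum_left inner_sum_left inner_sum_right)

lemma selfadjoint_scaleR: "selfadjoint A \<Longrightarrow> selfadjoint (c *\<^sub>R A)"
  by (simp add: selfadjoint_def blinfun.scaleR_left)

text \<open>A maximiser \<open>x\<close> of the quadratic form on the unit sphere of
  \<open>W\<close> is an eigenvector: if its residual \<open>w\<close> were nonzero, moving along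
  \<open>w\<close> inside \<open>W\<close> would raise the Rayleigh quotient.\<close>

lemma selfadjoint_eigenvector_in_subspace:
  fixes A :: "'a::euclidean_space \<Rightarrow>\<^sub>L 'a"
  assumes A: "selfadjoint A" and W: "subspace W" "W \<noteq> {0}" "\<And>x. x \<in> W \<Longrightarrow> A x \<in> W"
  obtains x r where "x \<in> W" "norm x = 1" "A x = r *\<^sub>R x"
proof -
  let ?K = "W \<inter> sphere 0 1"
  obtain y where y: "y \<in> W" "y \<noteq> 0" using W(1,2) subspace_0 by blast
  have "y /\<^sub>R norm y \<in> ?K" using y W(1) by (auto intro: subspace_scale)
  then have ne: "?K \<noteq> {}" by blast
  have cpt: "compact ?K" using closed_subspace[OF W(1)] by (simp add: closed_Int_compact)
  have "continuous_on ?K (\<lambda>x. x \<bullet> A x)" by (intro continuous_intros)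
  then obtain x where x: "x \<in> ?K" "\<And>z. z \<in> ?K \<Longrightarrow> z \<bullet> A z \<le> x \<bullet> A x"
    using continuous_attains_sup[OF cpt ne] by blast
  define r where "r = x \<bullet> A x"
  define w where "w = r *\<^sub>R x - A x"
  have le: "z \<bullet> A z \<le> r * (z \<bullet> z)" if "z \<in> W" for z
  proof (cases "z = 0")
    case False
    have "z /\<^sub>R norm z \<in> ?K" using that False W(1) by (auto intro: subspace_scale)
    from x(2)[OF this] have "(z \<bullet> A z) / (norm z)\<^sup>2 \<le> r"
      by (simp add: r_def blinfun.scaleR_right power2_eq_square field_simps)
    then show ?thesis using False by (simp add: field_simps dot_square_norm)
  qed simp
  have xW: "x \<in> W" and xx: "x \<bullet> x = 1" using x(1) by (auto simp: norm_eq_1)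
  have wW: "w \<in> W" unfolding w_def using xW W by (auto intro: subspace_diff subspace_scale)
  define b g where "b = w \<bullet> w" and "g = r * (w \<bullet> w) - w \<bullet> A w"
  have g0: "g \<ge> 0" using le[OF wW] by (simp add: g_def)
  \<comment> \<open>This is \<open>le\<close> at \<open>x + s *\<^sub>R w\<close>. The constant term
    drops out because \<open>r\<close> is the value of the form at the unit vector \<open>x\<close>,
    so the linear coefficient must vanish too.\<close>
  have q: "0 \<le> 2 * s * b + s\<^sup>2 * g" for s
  proof -
    have "x + s *\<^sub>R w \<in> W" using xW wW W(1) by (auto intro: subspace_add subspace_scale)
    from le[OF this] have "0 \<le> r * ((x + s *\<^sub>R w) \<bullet> (x + s *\<^sub>R w)) - (x + s *\<^sub>R w) \<bullet> A (x + s *\<^sub>R w)"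
      by simp
    also have "\<dots> = 2 * s * (r * (x \<bullet> w) - w \<bullet> A x) + s\<^sup>2 * g"
    proof -
      have "x \<bullet> A w = w \<bullet> A x" using A by (metis selfadjoint_def inner_commute)
      then show ?thesis using xx
        by (simp add: g_def r_def blinfun.add_right blinfun.scaleR_right inner_simps inner_commute[of w x]
            power2_eq_square algebra_simps)
    qed
    also have "r * (x \<bullet> w) - w \<bullet> A x = b"
    proof -
      have "b = w \<bullet> (r *\<^sub>R x - A x)" by (simp add: b_def w_def)
      then show ?thesis by (simp add: inner_diff_right inner_commute[of w x])
    qed
    finally show ?thesis .
  qed
  have "b = 0"
  proof (rule ccontr)
    assume "b \<noteq> 0"
    then have "b > 0" by (simp add: b_def)
    \<comment> \<open>The minimiser would be \<open>- b / g\<close>; the denominator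
      \<open>1 + g\<close> also covers \<open>g = 0\<close>.\<close>
    have "2 * (- b / (1+g)) * b + (- b / (1+g))\<^sup>2 * g = - (b\<^sup>2 * (2 + g)) / (1+g)\<^sup>2"
      using g0 by (simp add: field_simps power2_eq_square add_nonneg_eq_0_iff)
    also have "\<dots> < 0" using \<open>b > 0\<close> g0 by (simp add: divide_neg_pos)
    finally show False using q[of "- b / (1+g)"] by simp
  qed
  then have "A x = r *\<^sub>R x" by (simp add: b_def w_def)
  then show thesis using that xW x(1) by auto
qed

text \<open>The eigenvalue of \<open>u\<close> is encoded as \<open>u \<bullet> A u\<close>, which
  spares a separate eigenvalue function. Multiplicities are counted by the distinct vectors of the
  set.\<close>

definition eigenbasis :: "('a::euclidean_space \<Rightarrow>\<^sub>L 'a) \<Rightarrow> 'a set \<Rightarrow> bool" where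
  "eigenbasis A U \<longleftrightarrow> pairwise orthogonal U \<and> (\<forall>u\<in>U. norm u = 1) \<and> span U = UNIV \<and>
     (\<forall>u\<in>U. A u = (u \<bullet> A u) *\<^sub>R u)"

lemma orthonormal_finite:
  fixes U :: "'a::euclidean_space set"
  assumes "pairwise orthogonal U" "\<And>u. u \<in> U \<Longrightarrow> norm u = 1"
  shows "finite U" "independent U" "card U \<le> DIM('a)"
proof -
  have "0 \<notin> U" using assms(2) by force
  then show i: "independent U" using assms(1) by (rule pairwise_orthogonal_independent[rotated])
  show "finite U" "card U \<le> DIM('a)" using independent_bound[OF i] by auto
qed

text \<open>Take an orthonormal set of eigenvectors of largest cardinality. Its orthogonal
  complement is invariant under \<open>A\<close> by self-adjointness, so a nonzero complement would
  supply one more eigenvector.\<close>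

lemma eigenbasis_exists:
  fixes A :: "'a::euclidean_space \<Rightarrow>\<^sub>L 'a"
  assumes A: "selfadjoint A"
  obtains U where "eigenbasis A U"
proof -
  define P where "P U \<longleftrightarrow> pairwise orthogonal U \<and> (\<forall>u\<in>U. norm u = 1) \<and> (\<forall>u\<in>U. A u = (u \<bullet> A u) *\<^sub>R u)" for U
  have "P {}" by (simp add: P_def)
  moreover have "\<forall>U. P U \<longrightarrow> card U < Suc (DIM('a))"
    using orthonormal_finite(3) unfolding P_def by (metis le_imp_less_Suc)
  ultimately obtain U where U: "P U" and max: "\<And>V. P V \<Longrightarrow> card V \<le> card U"
    using ex_has_greatest_nat[of P "{}" card] by blast
  let ?W = "{x. \<forall>u\<in>U. orthogonal u x}"
  have W: "subspace ?W" by (rule subspace_orthogonal_to_vectors)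
  have inv: "A x \<in> ?W" if "x \<in> ?W" for x
  proof clarify
    fix u assume "u \<in> U"
    have "u \<bullet> A x = A u \<bullet> x" using A by (simp add: selfadjoint_def)
    also have "\<dots> = (u \<bullet> A u) * (u \<bullet> x)" using U \<open>u \<in> U\<close> unfolding P_def by (metis inner_scaleR_left)
    also have "u \<bullet> x = 0" using that \<open>u \<in> U\<close> by (simp add: orthogonal_def)
    finally show "orthogonal u (A x)" by (simp add: orthogonal_def)
  qed
  have fin: "finite U" using U orthonormal_finite(1) unfolding P_def by blast
  have "?W = {0}"
  proof (rule ccontr)
    assume "?W \<noteq> {0}"
    then obtain x r where x: "x \<in> ?W" "norm x = 1" "A x = r *\<^sub>R x"
      using selfadjoint_eigenvector_in_subspace[OF A W _ inv] by blast
    have "x \<notin> U" using x(1,2) by (auto simp: orthogonal_def)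
    have "x \<bullet> A x = r" using x by (simp add: norm_eq_1)
    then have "A x = (x \<bullet> A x) *\<^sub>R x" using x(3) by simp
    moreover have "pairwise orthogonal (insert x U)"
      using U x(1) unfolding P_def pairwise_insert by (simp add: orthogonal_commute)
    ultimately have "P (insert x U)" using U x(2) unfolding P_def by blast
    from max[OF this] show False using fin \<open>x \<notin> U\<close> by simp
  qed
  have "span U = UNIV"
  proof (rule ccontr)
    assume "span U \<noteq> UNIV"
    then have "span U \<subset> span UNIV" by auto
    from orthogonal_to_subspace_exists_gen[OF this]
    obtain x where "x \<noteq> 0" "\<And>y. y \<in> span U \<Longrightarrow> orthogonal x y" by metis
    then have "x \<in> ?W" using span_base orthogonal_commute by blast
    then show False using \<open>?W = {0}\<close> \<open>x \<noteq> 0\<close> by auto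
  qed
  then show thesis using that U unfolding eigenbasis_def P_def by blast
qed

context
  fixes A :: "'a::euclidean_space \<Rightarrow>\<^sub>L 'a" and U
  assumes U: "eigenbasis A U"
begin

lemma eigenbasis_finite: "finite U"
  using U orthonormal_finite(1) unfolding eigenbasis_def by blast

lemma eigenbasis_card: "card U = DIM('a)"
  using U orthonormal_finite(2)[of U] unfolding eigenbasis_def by (metis dim_UNIV dim_span_eq_card_independent)

lemma eigenbasis_norm: "u \<in> U \<Longrightarrow> norm u = 1"
  using U unfolding eigenbasis_def by blast

lemma eigenbasis_eigenvector: "u \<in> U \<Longrightarrow> A u = (u \<bullet> A u) *\<^sub>R u"
  using U unfolding eigenbasis_def by blast

lemma eigenbasis_inner: "(\<Sum>u\<in>U. (u \<bullet> x) * (u \<bullet> y)) = x \<bullet> y"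
proof -
  have "(\<Sum>u\<in>U. (u \<bullet> x) *\<^sub>R u) = x"
    using orthonormal_basis_expand[of U x] U eigenbasis_finite
    by (auto simp: eigenbasis_def inner_commute[of _ x])
  then have "x \<bullet> y = (\<Sum>u\<in>U. (u \<bullet> x) *\<^sub>R u) \<bullet> y" by simp
  then show ?thesis by (simp add: inner_sum_left)
qed

lemma eigenbasis_parseval: "(\<Sum>u\<in>U. (u \<bullet> x)\<^sup>2) = (norm x)\<^sup>2"
  using eigenbasis_inner[of x x] by (simp add: power2_eq_square[of "inner _ _"] dot_square_norm)

end

subsection \<open>Trace exponentials\<close>

text \<open>The constants 1/3 and 1/6 are the integrals of \<open>(1 - s)^2\<close> and
  \<open>s (1 - s)\<close> over [0,1]: they arise when \<open>exp (s x)\<close> in the Taylor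
  remainder is bounded by its chord. The proof instead shows that the difference \<open>f\<close> of
  the two sides is convex, which reduces to \<open>exp (-x) \<ge> 1 - x\<close>, and that its
  tangent at 0 is zero.\<close>

lemma exp_minus_linear_le:
  fixes x :: real
  shows "exp x - 1 - x \<le> x\<^sup>2 * (1/3 + exp x / 6)"
proof -
  define f f' f'' where "f = (\<lambda>x::real. 1 + x + x\<^sup>2/3 + exp x * (x\<^sup>2/6 - 1))"
    and "f' = (\<lambda>x::real. 1 + 2*x/3 + exp x * (x\<^sup>2/6 + x/3 - 1))"
    and "f'' = (\<lambda>x::real. 2/3 + exp x * (x\<^sup>2/6 + 2*x/3 - 2/3))"
  have d1: "(f has_real_derivative f' x) (at x)" for x
    unfolding f_def f'_def by (auto intro!: derivative_eq_intros simp: algebra_simps)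
  have d2: "(f' has_real_derivative f'' x) (at x)" for x
    unfolding f'_def f''_def by (auto intro!: derivative_eq_intros simp: field_simps)
  have "f'' x \<ge> 0" for x
  proof -
    have "2/3 - 2*x/3 - x\<^sup>2/6 \<le> 2/3 * exp (-x)"
      using exp_ge_add_one_self[of "-x"] zero_le_power2[of x] by linarith
    then have "exp x * (2/3 - 2*x/3 - x\<^sup>2/6) \<le> exp x * (2/3 * exp (-x))"
      by (rule mult_left_mono) simp
    also have "\<dots> = 2/3" by (simp add: exp_minus)
    finally show ?thesis unfolding f''_def by (simp add: algebra_simps)
  qed
  then have "convex_on UNIV f"
    by (intro f''_ge0_imp_convex[where f'=f' and f''=f'']) (auto intro: d1 d2)
  then have "f x \<ge> f 0 + f' 0 * (x - 0)"
    using convex_on_imp_above_tangent[of UNIV f 0 x "f' 0"] d1[of 0] by simp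
  then show ?thesis by (simp add: f_def f'_def algebra_simps)
qed

text \<open>\<open>Tr exp (\<theta> A)\<close>, the trace being that of an operator on a real space.\<close>

definition trexp :: "real \<Rightarrow> ('a::euclidean_space \<Rightarrow>\<^sub>L 'a) \<Rightarrow> real" where
  "trexp \<theta> A = (let U = (SOME U. eigenbasis A U) in \<Sum>u\<in>U. exp (\<theta> * (u \<bullet> A u)))"

lemma trexp_obtain:
  assumes "selfadjoint A"
  obtains U where "eigenbasis A U" "\<And>\<theta>. trexp \<theta> A = (\<Sum>u\<in>U. exp (\<theta> * (u \<bullet> A u)))"
proof -
  have "eigenbasis A (SOME U. eigenbasis A U)"
    using eigenbasis_exists[OF assms] by (metis someI)
  then show thesis using that by (simp add: trexp_def Let_def)
qed

lemma trexp_nonneg: "trexp \<theta> A \<ge> 0"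
  by (simp add: trexp_def Let_def sum_nonneg)

lemma trexp_zero: "trexp \<theta> (0 :: 'a::euclidean_space \<Rightarrow>\<^sub>L 'a) = DIM('a)"
proof -
  have "selfadjoint (0 :: 'a \<Rightarrow>\<^sub>L 'a)" by (simp add: selfadjoint_def)
  then obtain U where U: "eigenbasis (0 :: 'a \<Rightarrow>\<^sub>L 'a) U"
    "trexp \<theta> (0 :: 'a \<Rightarrow>\<^sub>L 'a) = (\<Sum>u\<in>U. exp (\<theta> * (u \<bullet> (0 :: 'a \<Rightarrow>\<^sub>L 'a) u)))"
    using trexp_obtain by blast
  then show ?thesis using eigenbasis_card[OF U(1)] by simp
qed

text \<open>Self-adjointness of \<open>B\<close> gives \<open>(v \<bullet> B v - a) * (u \<bullet>
  v) = v \<bullet> (B - A) u\<close>. Hence the sums are an inner product and a squared norm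
  expanded in the basis \<open>V\<close>.\<close>

lemma eigenbasis_sum_weighted_deviation:
  fixes A B :: "'a::euclidean_space \<Rightarrow>\<^sub>L 'a"
  assumes V: "eigenbasis B V" and B: "selfadjoint B" and u: "norm u = 1" "A u = a *\<^sub>R u"
  shows "(\<Sum>v\<in>V. (u \<bullet> v)\<^sup>2 * (v \<bullet> B v - a)) = u \<bullet> (B - A) u"
    and "(\<Sum>v\<in>V. (u \<bullet> v)\<^sup>2 * (v \<bullet> B v - a)\<^sup>2) = (norm ((B - A) u))\<^sup>2"
proof -
  have eq: "(v \<bullet> B v - a) * (u \<bullet> v) = v \<bullet> (B - A) u" if "v \<in> V" for v
  proof -
    have "v \<bullet> B u = B v \<bullet> u" using B by (simp add: selfadjoint_def)
    also have "\<dots> = (v \<bullet> B v) * (v \<bullet> u)"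
      using eigenbasis_eigenvector[OF V that] by (metis inner_scaleR_left)
    finally show ?thesis
      by (simp add: blinfun.diff_left inner_diff_right u(2) inner_commute[of v u] left_diff_distrib)
  qed
  have "(\<Sum>v\<in>V. (u \<bullet> v)\<^sup>2 * (v \<bullet> B v - a)) = (\<Sum>v\<in>V. (v \<bullet> u) * (v \<bullet> (B - A) u))"
    by (intro sum.cong refl) (simp add: eq[symmetric] power2_eq_square inner_commute)
  then show "(\<Sum>v\<in>V. (u \<bullet> v)\<^sup>2 * (v \<bullet> B v - a)) = u \<bullet> (B - A) u"
    by (simp add: eigenbasis_inner[OF V])
  have "(\<Sum>v\<in>V. (u \<bullet> v)\<^sup>2 * (v \<bullet> B v - a)\<^sup>2) = (\<Sum>v\<in>V. (v \<bullet> (B - A) u)\<^sup>2)"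
    by (intro sum.cong refl) (simp add: eq[symmetric] power_mult_distrib)
  then show "(\<Sum>v\<in>V. (u \<bullet> v)\<^sup>2 * (v \<bullet> B v - a)\<^sup>2) = (norm ((B - A) u))\<^sup>2"
    by (simp add: eigenbasis_parseval[OF V])
qed

text \<open>The doubly stochastic weights \<open>w u v\<close> compare the two spectra although
  \<open>A\<close> and \<open>B\<close> need not commute. The quantity to be bounded also occurs on
  the right; it is absorbed only after averaging.\<close>

lemma trace_exp_perturbation:
  fixes A B :: "'a::euclidean_space \<Rightarrow>\<^sub>L 'a"
  assumes A: "selfadjoint A" and B: "selfadjoint B" and U: "eigenbasis A U" and V: "eigenbasis B V"
    and c: "norm (B - A) \<le> c"
  defines "\<alpha> \<equiv> \<lambda>u. u \<bullet> A u" and "\<beta> \<equiv> \<lambda>v. v \<bullet> B v"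
  shows "(\<Sum>v\<in>V. exp (\<theta> * \<beta> v)) \<le> (\<Sum>u\<in>U. exp (\<theta> * \<alpha> u))
     + \<theta> * (\<Sum>u\<in>U. exp (\<theta> * \<alpha> u) * (u \<bullet> (B - A) u))
     + \<theta>\<^sup>2 * c\<^sup>2 * ((\<Sum>u\<in>U. exp (\<theta> * \<alpha> u)) / 3 + (\<Sum>v\<in>V. exp (\<theta> * \<beta> v)) / 6)"
proof -
  define w where "w u v = (u \<bullet> v)\<^sup>2" for u v :: 'a
  have w1: "(\<Sum>v\<in>V. w u v) = 1" if "u \<in> U" for u
    using eigenbasis_parseval[OF V, of u] eigenbasis_norm[OF U that] by (simp add: w_def inner_commute)
  have w2: "(\<Sum>u\<in>U. w u v) = 1" if "v \<in> V" for v
    using eigenbasis_parseval[OF U, of v] eigenbasis_norm[OF V that] by (simp add: w_def)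
  have bd: "(norm ((B - A) x))\<^sup>2 \<le> c\<^sup>2" if "norm x = 1" for x
  proof (rule power_mono)
    show "norm ((B - A) x) \<le> c" using norm_blinfun[of "B - A" x] that c by simp
  qed simp
  have sA1: "(\<Sum>v\<in>V. w u v * (\<beta> v - \<alpha> u)) = u \<bullet> (B - A) u"
    and sA2: "(\<Sum>v\<in>V. w u v * (\<beta> v - \<alpha> u)\<^sup>2) \<le> c\<^sup>2" if "u \<in> U" for u
    using eigenbasis_sum_weighted_deviation[OF V B eigenbasis_norm[OF U that] eigenbasis_eigenvector[OF U that]]
      bd[OF eigenbasis_norm[OF U that]]
    by (simp_all add: w_def \<alpha>_def \<beta>_def)
  \<comment> \<open>The roles of \<open>A\<close> and \<open>B\<close> are exchanged here; the
    weights and the squared deviation are symmetric.\<close>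
  have sB2: "(\<Sum>u\<in>U. w u v * (\<beta> v - \<alpha> u)\<^sup>2) \<le> c\<^sup>2" if "v \<in> V" for v
    using eigenbasis_sum_weighted_deviation(2)[OF U A eigenbasis_norm[OF V that] eigenbasis_eigenvector[OF V that]]
      bd[OF eigenbasis_norm[OF V that]]
    by (simp add: w_def \<alpha>_def \<beta>_def inner_commute blinfun.diff_left norm_minus_commute power2_commute)
  let ?S = "\<Sum>u\<in>U. exp (\<theta> * \<alpha> u)" and ?T = "\<Sum>v\<in>V. exp (\<theta> * \<beta> v)"
  \<comment> \<open>Multiplication by \<open>exp (\<theta> * a)\<close> turns the factor
    \<open>exp x\<close> of the scalar inequality into \<open>exp (\<theta> * b)\<close>, so each
    second-order term depends on only one spectrum apart from the squared deviation.\<close>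
  have pt: "exp (\<theta> * b) \<le> exp (\<theta> * a) + \<theta> * (exp (\<theta> * a) * (b - a))
      + \<theta>\<^sup>2 / 3 * (exp (\<theta> * a) * (b - a)\<^sup>2) + \<theta>\<^sup>2 / 6 * (exp (\<theta> * b) * (b - a)\<^sup>2)" for a b
  proof -
    have "exp (\<theta> * b) = exp (\<theta> * a) * exp (\<theta> * (b - a))"
      by (simp add: exp_add[symmetric] algebra_simps)
    moreover have "exp (\<theta> * a) * exp (\<theta> * (b - a)) \<le> exp (\<theta> * a) *
       (1 + \<theta> * (b - a) + (\<theta> * (b - a))\<^sup>2 * (1/3 + exp (\<theta> * (b - a)) / 6))"
      by (rule mult_left_mono) (use exp_minus_linear_le[of "\<theta> * (b - a)"] in auto)
    moreover have "x * (1 + \<theta> * d + (\<theta> * d)\<^sup>2 * (1/3 + y / 6))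
        = x + \<theta> * (x * d) + \<theta>\<^sup>2 / 3 * (x * d\<^sup>2) + \<theta>\<^sup>2 / 6 * (x * y * d\<^sup>2)" for x y d :: real
      by (simp add: field_simps power2_eq_square)
    ultimately show ?thesis by metis
  qed
  have "?T = (\<Sum>v\<in>V. (\<Sum>u\<in>U. w u v) * exp (\<theta> * \<beta> v))" using w2 by simp
  also have "\<dots> = (\<Sum>u\<in>U. \<Sum>v\<in>V. w u v * exp (\<theta> * \<beta> v))"
    by (simp add: sum_distrib_right sum.swap[of _ V U])
  also have "\<dots> \<le> (\<Sum>u\<in>U. \<Sum>v\<in>V. w u v * (exp (\<theta> * \<alpha> u) + \<theta> * (exp (\<theta> * \<alpha> u) * (\<beta> v - \<alpha> u))
      + \<theta>\<^sup>2 / 3 * (exp (\<theta> * \<alpha> u) * (\<beta> v - \<alpha> u)\<^sup>2) + \<theta>\<^sup>2 / 6 * (exp (\<theta> * \<beta> v) * (\<beta> v - \<alpha> u)\<^sup>2)))"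
    by (intro sum_mono mult_left_mono pt) (simp add: w_def)
  also have "\<dots> = (\<Sum>u\<in>U. exp (\<theta> * \<alpha> u) * (\<Sum>v\<in>V. w u v))
      + \<theta> * (\<Sum>u\<in>U. exp (\<theta> * \<alpha> u) * (\<Sum>v\<in>V. w u v * (\<beta> v - \<alpha> u)))
      + \<theta>\<^sup>2 / 3 * (\<Sum>u\<in>U. exp (\<theta> * \<alpha> u) * (\<Sum>v\<in>V. w u v * (\<beta> v - \<alpha> u)\<^sup>2))
      + \<theta>\<^sup>2 / 6 * (\<Sum>u\<in>U. \<Sum>v\<in>V. exp (\<theta> * \<beta> v) * (w u v * (\<beta> v - \<alpha> u)\<^sup>2))"
    by (simp add: sum.distrib sum_distrib_left sum_distrib_right distrib_left mult_ac)
  also have "(\<Sum>u\<in>U. \<Sum>v\<in>V. exp (\<theta> * \<beta> v) * (w u v * (\<beta> v - \<alpha> u)\<^sup>2))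
      = (\<Sum>v\<in>V. exp (\<theta> * \<beta> v) * (\<Sum>u\<in>U. w u v * (\<beta> v - \<alpha> u)\<^sup>2))"
    by (subst sum.swap) (simp add: sum_distrib_left)
  also have "(\<Sum>u\<in>U. exp (\<theta> * \<alpha> u) * (\<Sum>v\<in>V. w u v)) = ?S" using w1 by simp
  also have "(\<Sum>u\<in>U. exp (\<theta> * \<alpha> u) * (\<Sum>v\<in>V. w u v * (\<beta> v - \<alpha> u)))
      = (\<Sum>u\<in>U. exp (\<theta> * \<alpha> u) * (u \<bullet> (B - A) u))" using sA1 by simp
  also have "?S + \<theta> * (\<Sum>u\<in>U. exp (\<theta> * \<alpha> u) * (u \<bullet> (B - A) u))
      + \<theta>\<^sup>2 / 3 * (\<Sum>u\<in>U. exp (\<theta> * \<alpha> u) * (\<Sum>v\<in>V. w u v * (\<beta> v - \<alpha> u)\<^sup>2))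
      + \<theta>\<^sup>2 / 6 * (\<Sum>v\<in>V. exp (\<theta> * \<beta> v) * (\<Sum>u\<in>U. w u v * (\<beta> v - \<alpha> u)\<^sup>2))
    \<le> ?S + \<theta> * (\<Sum>u\<in>U. exp (\<theta> * \<alpha> u) * (u \<bullet> (B - A) u))
      + \<theta>\<^sup>2 / 3 * (\<Sum>u\<in>U. exp (\<theta> * \<alpha> u) * c\<^sup>2) + \<theta>\<^sup>2 / 6 * (\<Sum>v\<in>V. exp (\<theta> * \<beta> v) * c\<^sup>2)"
    by (intro add_mono mult_left_mono sum_mono sA2 sB2 order_refl) auto
  also have "\<dots> = ?S + \<theta> * (\<Sum>u\<in>U. exp (\<theta> * \<alpha> u) * (u \<bullet> (B - A) u)) + \<theta>\<^sup>2 * c\<^sup>2 * (?S / 3 + ?T / 6)"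
    unfolding sum_distrib_right[symmetric] by (simp add: algebra_simps)
  finally show ?thesis .
qed

text \<open>One martingale step. The first-order term is linear in \<open>B i - A\<close> and
  averages to 0; the multiple of the left side that appears on the right is moved over, which is
  where \<open>small\<close> keeps the denominator positive.\<close>

lemma trexp_mean_le:
  fixes A :: "'a::euclidean_space \<Rightarrow>\<^sub>L 'a" and B :: "'i \<Rightarrow> 'a \<Rightarrow>\<^sub>L 'a"
  assumes A: "selfadjoint A" and B: "\<And>i. i \<in> I \<Longrightarrow> selfadjoint (B i)"
    and w: "\<And>i. i \<in> I \<Longrightarrow> 0 \<le> w i" "(\<Sum>i\<in>I. w i) = 1"
    and mean: "(\<Sum>i\<in>I. w i *\<^sub>R B i) = A"
    and c: "\<And>i. i \<in> I \<Longrightarrow> norm (B i - A) \<le> c"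
    and small: "\<theta>\<^sup>2 * c\<^sup>2 < 6"
  shows "(\<Sum>i\<in>I. w i * trexp \<theta> (B i)) \<le> (1 + \<theta>\<^sup>2 * c\<^sup>2 / 3) / (1 - \<theta>\<^sup>2 * c\<^sup>2 / 6) * trexp \<theta> A"
proof -
  obtain U where U: "eigenbasis A U" "trexp \<theta> A = (\<Sum>u\<in>U. exp (\<theta> * (u \<bullet> A u)))"
    using trexp_obtain[OF A] by metis
  define q where "q = \<theta>\<^sup>2 * c\<^sup>2"
  let ?l = "\<lambda>C. \<Sum>u\<in>U. exp (\<theta> * (u \<bullet> A u)) * (u \<bullet> blinfun_apply C u)"
  have step: "trexp \<theta> (B i) \<le> trexp \<theta> A + \<theta> * ?l (B i - A) + q * (trexp \<theta> A / 3 + trexp \<theta> (B i) / 6)"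
    if i: "i \<in> I" for i
  proof -
    obtain V where V: "eigenbasis (B i) V" "trexp \<theta> (B i) = (\<Sum>v\<in>V. exp (\<theta> * (v \<bullet> B i v)))"
      using trexp_obtain[OF B[OF i]] by metis
    show ?thesis unfolding U(2) V(2) q_def by (rule trace_exp_perturbation[OF A B[OF i] U(1) V(1) c[OF i]])
  qed
  have "(\<Sum>i\<in>I. w i * ?l (B i - A)) = ?l (\<Sum>i\<in>I. w i *\<^sub>R (B i - A))"
    by (simp add: blinfun.sum_left blinfun.scaleR_left inner_sum_right sum_distrib_left mult_ac) (rule sum.swap)
  also have "(\<Sum>i\<in>I. w i *\<^sub>R (B i - A)) = 0"
    using mean w(2) by (simp add: scaleR_diff_right sum_subtractf scaleR_left.sum[symmetric])
  finally have l0: "(\<Sum>i\<in>I. w i * ?l (B i - A)) = 0" by simp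
  let ?E = "\<Sum>i\<in>I. w i * trexp \<theta> (B i)"
  have "?E \<le> (\<Sum>i\<in>I. w i * (trexp \<theta> A + \<theta> * ?l (B i - A) + q * (trexp \<theta> A / 3 + trexp \<theta> (B i) / 6)))"
    by (intro sum_mono mult_left_mono step w(1))
  also have "\<dots> = (\<Sum>i\<in>I. w i) * trexp \<theta> A + \<theta> * (\<Sum>i\<in>I. w i * ?l (B i - A))
      + q * ((\<Sum>i\<in>I. w i) * trexp \<theta> A / 3 + ?E / 6)"
    by (simp add: distrib_left sum.distrib sum_distrib_left sum_distrib_right sum_divide_distrib mult_ac)
  also have "\<dots> = (1 + q / 3) * trexp \<theta> A + q * ?E / 6" using l0 w(2) by (simp add: algebra_simps)
  finally have "(1 - q / 6) * ?E \<le> (1 + q / 3) * trexp \<theta> A" by (simp add: algebra_simps)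
  moreover have "1 - q / 6 > 0" using small by (simp add: q_def)
  ultimately show ?thesis unfolding q_def[symmetric] by (simp add: field_simps)
qed

section \<open>Lower bounds for the trace exponential by single eigenvalues\<close>

lemma eigenvalue_weight:
  fixes A :: "'a::euclidean_space \<Rightarrow>\<^sub>L 'a"
  assumes A: "selfadjoint A" and U: "eigenbasis A U" and v: "A v = r *\<^sub>R v" and u: "u \<in> U" "u \<bullet> v \<noteq> 0"
  shows "u \<bullet> A u = r"
proof -
  have "r * (u \<bullet> v) = A u \<bullet> v" using A v by (simp add: selfadjoint_def)
  also have "\<dots> = (u \<bullet> A u) * (u \<bullet> v)"
    using eigenbasis_eigenvector[OF U u(1)] by (metis inner_scaleR_left)
  finally show ?thesis using u(2) by simp
qed

text \<open>The basis behind \<open>trexp\<close> need not contain \<open>v\<close> or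
  \<open>w\<close>. Their total mass 2 is spread over basis vectors with eigenvalue
  \<open>r\<close>, and by Bessel's inequality no basis vector receives more than 1.\<close>

lemma trexp_ge_double_eigenvalue:
  fixes A :: "'a::euclidean_space \<Rightarrow>\<^sub>L 'a"
  assumes A: "selfadjoint A" and v: "norm v = 1" "A v = r *\<^sub>R v" and w: "norm w = 1" "A w = r *\<^sub>R w"
    and orth: "v \<bullet> w = 0"
  shows "2 * exp (\<theta> * r) \<le> trexp \<theta> A"
proof -
  obtain U where U: "eigenbasis A U" "trexp \<theta> A = (\<Sum>u\<in>U. exp (\<theta> * (u \<bullet> A u)))"
    using trexp_obtain[OF A] by metis
  have bessel: "(u \<bullet> v)\<^sup>2 + (u \<bullet> w)\<^sup>2 \<le> 1" if "u \<in> U" for u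
  proof -
    let ?z = "u - (u \<bullet> v) *\<^sub>R v - (u \<bullet> w) *\<^sub>R w"
    have "v \<bullet> v = 1" "w \<bullet> w = 1" "u \<bullet> u = 1" "w \<bullet> v = 0"
      using v(1) w(1) eigenbasis_norm[OF U(1) that] orth by (simp_all add: norm_eq_1 inner_commute)
    then have "?z \<bullet> ?z = 1 - (u \<bullet> v)\<^sup>2 - (u \<bullet> w)\<^sup>2"
      using orth by (simp add: inner_diff_left inner_diff_right inner_commute[of v u] inner_commute[of w u] power2_eq_square)
    then show ?thesis using inner_ge_zero[of ?z] by linarith
  qed
  have "2 * exp (\<theta> * r) = (\<Sum>u\<in>U. ((u \<bullet> v)\<^sup>2 + (u \<bullet> w)\<^sup>2) * exp (\<theta> * r))"
    using eigenbasis_parseval[OF U(1), of v] eigenbasis_parseval[OF U(1), of w] v(1) w(1)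
    by (simp add: sum_distrib_right[symmetric] sum.distrib)
  also have "\<dots> = (\<Sum>u\<in>U. ((u \<bullet> v)\<^sup>2 + (u \<bullet> w)\<^sup>2) * exp (\<theta> * (u \<bullet> A u)))"
  proof (rule sum.cong[OF refl])
    fix u assume "u \<in> U"
    then show "((u \<bullet> v)\<^sup>2 + (u \<bullet> w)\<^sup>2) * exp (\<theta> * r) = ((u \<bullet> v)\<^sup>2 + (u \<bullet> w)\<^sup>2) * exp (\<theta> * (u \<bullet> A u))"
      using eigenvalue_weight[OF A U(1) v(2), of u] eigenvalue_weight[OF A U(1) w(2), of u]
      by (cases "u \<bullet> v = 0"; cases "u \<bullet> w = 0") auto
  qed
  also have "\<dots> \<le> (\<Sum>u\<in>U. 1 * exp (\<theta> * (u \<bullet> A u)))"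
    by (intro sum_mono mult_right_mono bessel) auto
  finally show ?thesis by (simp add: U(2))
qed

subsection \<open>Revealing the ones of a homogeneous measure\<close>

lemma finite_cube: "finite T \<Longrightarrow> finite (cube T)"
  unfolding cube_def by (intro finite_PiE) auto

lemma cube_01: "\<xi> \<in> cube T \<Longrightarrow> i \<in> T \<Longrightarrow> \<xi> i = 0 \<or> \<xi> i = 1"
  unfolding cube_def by (auto dest: PiE_mem)

text \<open>Carries a sample of \<open>cond_law\<close>, which lives on \<open>T - Z\<close>, back
  to \<open>T\<close>. Values outside \<open>Z\<close>, including \<open>undefined\<close> outside
  \<open>T\<close>, come from \<open>\<eta>\<close>, so the result stays extensional.\<close>

definition glue :: "'a set \<Rightarrow> ('a \<Rightarrow> real) \<Rightarrow> ('a \<Rightarrow> real) \<Rightarrow> 'a \<Rightarrow> real" where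
  "glue Z x \<eta> = (\<lambda>i. if i \<in> Z then x i else \<eta> i)"

lemma glue_cube: "Z \<subseteq> T \<Longrightarrow> x \<in> cube Z \<Longrightarrow> \<eta> \<in> cube (T - Z) \<Longrightarrow> glue Z x \<eta> \<in> cube T"
  by (auto simp: cube_def glue_def PiE_iff extensional_def)

lemma glue_restrict: "Z \<subseteq> T \<Longrightarrow> \<xi> \<in> cube T \<Longrightarrow> restrict \<xi> Z = x \<Longrightarrow> glue Z x (restrict \<xi> (T - Z)) = \<xi>"
  by (rule ext) (auto simp: cube_def glue_def PiE_iff extensional_def)

lemma l1_dist_on_glue:
  assumes "finite T" "Z \<subseteq> T"
  shows "l1_dist_on T (glue Z x \<eta>) (glue Z x' \<eta>') = l1_dist_on Z x x' + l1_dist_on (T - Z) \<eta> \<eta>'"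
proof -
  have "l1_dist_on T (glue Z x \<eta>) (glue Z x' \<eta>')
      = (\<Sum>i\<in>Z. \<bar>glue Z x \<eta> i - glue Z x' \<eta>' i\<bar>) + (\<Sum>i\<in>T - Z. \<bar>glue Z x \<eta> i - glue Z x' \<eta>' i\<bar>)"
    unfolding l1_dist_on_def using assms by (simp add: sum.subset_diff)
  then show ?thesis by (simp add: l1_dist_on_def glue_def)
qed

lemma l1_dist_on_commute: "l1_dist_on T x y = l1_dist_on T y x"
  by (simp add: l1_dist_on_def abs_minus_commute)

lemma covered_by_l1_dist_le:
  assumes "finite T" "covered_by T x y"
  shows "l1_dist_on T x y \<le> 1"
proof (cases "x = y")
  case False
  then obtain i where i: "i \<in> T" "x i = 0" "y i = 1" "\<forall>j\<in>T - {i}. x j = y j"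
    using assms(2) unfolding covered_by_def by auto
  have "l1_dist_on T x y = \<bar>x i - y i\<bar> + (\<Sum>j\<in>T - {i}. \<bar>x j - y j\<bar>)"
    unfolding l1_dist_on_def using assms(1) i(1) by (rule sum.remove)
  also have "(\<Sum>j\<in>T - {i}. \<bar>x j - y j\<bar>) = 0" using i(4) by simp
  finally show ?thesis using i by simp
qed (simp add: l1_dist_on_def)

text \<open>Under the coupling the difference of expectations is the expectation of
  \<open>g x - h y\<close>. Two functions are allowed because the two laws are later glued to
  different revealed parts.\<close>

lemma stoch_covered_by_expectation_diff:
  fixes g h :: "('a \<Rightarrow> real) \<Rightarrow> 'e::euclidean_space"
  assumes T: "finite T" and cov: "stoch_covered_by T \<nu>1 \<nu>2"
    and le: "\<And>x y. covered_by T x y \<Longrightarrow> norm (g x - h y) \<le> c"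
  shows "norm (measure_pmf.expectation \<nu>1 g - measure_pmf.expectation \<nu>2 h) \<le> c"
proof -
  obtain \<kappa> where \<kappa>: "map_pmf fst \<kappa> = \<nu>1" "map_pmf snd \<kappa> = \<nu>2" "set_pmf \<kappa> \<subseteq> {(x, y). covered_by T x y}"
    using cov unfolding stoch_covered_by_def by blast
  have "set_pmf \<kappa> \<subseteq> cube T \<times> cube T" using \<kappa>(3) by (auto simp: covered_by_def)
  then have fin: "finite (set_pmf \<kappa>)" using finite_cube[OF T] by (meson finite_SigmaI finite_subset)
  have int: "integrable (measure_pmf \<kappa>) (\<lambda>z. F z)" for F :: "_ \<Rightarrow> 'b::{banach,second_countable_topology}"
    by (rule integrable_measure_pmf_finite[OF fin])
  have "measure_pmf.expectation \<nu>1 g - measure_pmf.expectation \<nu>2 h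
      = measure_pmf.expectation \<kappa> (\<lambda>z. g (fst z) - h (snd z))"
    unfolding \<kappa>(1,2)[symmetric] by (simp add: int)
  also have "norm \<dots> \<le> measure_pmf.expectation \<kappa> (\<lambda>z. norm (g (fst z) - h (snd z)))"
    by (rule integral_norm_bound)
  also have "\<dots> \<le> c"
  proof (rule measure_pmf.integral_le_const)
    show "AE z in measure_pmf \<kappa>. norm (g (fst z) - h (snd z)) \<le> c"
      using \<kappa>(3) le by (auto simp: AE_measure_pmf_iff)
  qed (rule int)
  finally show ?thesis .
qed

lemma prob_eq_sum_cube:
  assumes "finite T" "set_pmf \<mu> \<subseteq> cube T"
  shows "measure_pmf.prob \<mu> {\<xi>. P \<xi>} = (\<Sum>\<xi>\<in>{\<xi>\<in>cube T. P \<xi>}. pmf \<mu> \<xi>)"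
proof -
  have "measure_pmf.prob \<mu> {\<xi>. P \<xi>} = measure_pmf.prob \<mu> {\<xi>\<in>cube T. P \<xi>}"
    by (rule measure_pmf.finite_measure_eq_AE) (use assms(2) in \<open>auto simp: AE_measure_pmf_iff\<close>)
  also have "\<dots> = (\<Sum>\<xi>\<in>{\<xi>\<in>cube T. P \<xi>}. pmf \<mu> \<xi>)"
    using finite_cube[OF assms(1)] by (intro measure_measure_pmf_finite) simp
  finally show ?thesis .
qed

text \<open>Bridge from \<open>cond_law\<close>, in which the covering property is phrased, to
  finite sums: conditioning divides the masses by the probability of the event, and gluing undoes
  the restriction.\<close>

lemma expectation_cond_law:
  fixes g :: "('a \<Rightarrow> real) \<Rightarrow> 'e::euclidean_space"
  assumes T: "finite T" "set_pmf \<mu> \<subseteq> cube T" and Z: "Z \<subseteq> T"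
    and pos: "measure_pmf.prob \<mu> {\<xi>. restrict \<xi> Z = x} > 0"
  shows "measure_pmf.prob \<mu> {\<xi>. restrict \<xi> Z = x} *\<^sub>R
      measure_pmf.expectation (cond_law T \<mu> Z x) (\<lambda>\<eta>. g (glue Z x \<eta>))
    = (\<Sum>\<xi>\<in>{\<xi>\<in>cube T. restrict \<xi> Z = x}. pmf \<mu> \<xi> *\<^sub>R g \<xi>)"
proof -
  let ?A = "{\<xi>. restrict \<xi> Z = x}"
  have ne: "set_pmf \<mu> \<inter> ?A \<noteq> {}"
    using pos measure_Int_set_pmf[of \<mu> ?A] by (metis Int_commute less_irrefl measure_empty)
  have "measure_pmf.expectation (cond_law T \<mu> Z x) (\<lambda>\<eta>. g (glue Z x \<eta>))
      = measure_pmf.expectation (cond_pmf \<mu> ?A) (\<lambda>\<xi>. g (glue Z x (restrict \<xi> (T - Z))))"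
    by (simp add: cond_law_def)
  also have "\<dots> = (\<Sum>\<xi>\<in>{\<xi>\<in>cube T. restrict \<xi> Z = x}. pmf (cond_pmf \<mu> ?A) \<xi> *\<^sub>R g (glue Z x (restrict \<xi> (T - Z))))"
    using finite_cube[OF T(1)] T(2) set_cond_pmf[OF ne] by (intro integral_measure_pmf) auto
  also have "\<dots> = (\<Sum>\<xi>\<in>{\<xi>\<in>cube T. restrict \<xi> Z = x}. (pmf \<mu> \<xi> / measure_pmf.prob \<mu> ?A) *\<^sub>R g \<xi>)"
    by (intro sum.cong refl) (simp add: pmf_cond[OF ne] glue_restrict[OF Z])
  finally show ?thesis using pos by (simp add: scaleR_sum_right)
qed

text \<open>Only ones are ever conditioned on, so the set of their positions is the whole state of the
  martingale.\<close>

definition revealed :: "'a set \<Rightarrow> 'a set \<Rightarrow> ('a \<Rightarrow> real) set" where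
  "revealed T S = {\<xi>\<in>cube T. \<forall>i\<in>S. \<xi> i = 1}"

definition weighted_sum :: "('a \<Rightarrow> real) pmf \<Rightarrow> ('a \<Rightarrow> real) set \<Rightarrow> (('a \<Rightarrow> real) \<Rightarrow> 'e) \<Rightarrow> 'e::real_vector" where
  "weighted_sum \<mu> X g = (\<Sum>\<xi>\<in>X. pmf \<mu> \<xi> *\<^sub>R g \<xi>)"

abbreviation weight :: "('a \<Rightarrow> real) pmf \<Rightarrow> ('a \<Rightarrow> real) set \<Rightarrow> real" where
  "weight \<mu> X \<equiv> weighted_sum \<mu> X (\<lambda>_. 1)"

text \<open>Conditional expectation given \<open>X\<close>; it is 0 when \<open>X\<close> has weight
  0, since \<open>inverse 0 = 0\<close>.\<close>

definition average :: "('a \<Rightarrow> real) pmf \<Rightarrow> ('a \<Rightarrow> real) set \<Rightarrow> (('a \<Rightarrow> real) \<Rightarrow> 'e) \<Rightarrow> 'e::real_vector" where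
  "average \<mu> X g = weighted_sum \<mu> X g /\<^sub>R weight \<mu> X"

lemma weight_nonneg: "weight \<mu> X \<ge> 0"
  by (simp add: weighted_sum_def sum_nonneg)

lemma weighted_sum_weight_0:
  assumes "finite X" "weight \<mu> X = 0"
  shows "weighted_sum \<mu> X g = 0"
  using assms by (simp add: weighted_sum_def sum_nonneg_eq_0_iff)

lemma weighted_sum_eq_average:
  assumes "finite X"
  shows "weighted_sum \<mu> X g = weight \<mu> X *\<^sub>R average \<mu> X g"
  using weighted_sum_weight_0[OF assms] by (cases "weight \<mu> X = 0") (auto simp: average_def)

lemma finite_revealed: "finite T \<Longrightarrow> finite (revealed T S)"
  unfolding revealed_def using finite_cube[of T] by simp

section \<open>Size of the martingale steps\<close>

text \<open>The 2 is 1 + 1: the conditions \<open>y\<close> and \<open>x\<close> differ at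
  \<open>i\<close> alone, and the covering property couples the remaining coordinates so that at
  most one of them differs.\<close>

lemma average_flip_diff:
  fixes g :: "('a \<Rightarrow> real) \<Rightarrow> 'e::euclidean_space"
  assumes T: "finite T" "set_pmf \<mu> \<subseteq> cube T" and scp: "stochastic_covering T \<mu>"
    and S: "S \<subseteq> T" and i: "i \<in> T - S"
    and lip: "\<And>x y. x \<in> cube T \<Longrightarrow> y \<in> cube T \<Longrightarrow> norm (g x - g y) \<le> L * l1_dist_on T x y"
    and L: "L \<ge> 0"
    and pos: "weight \<mu> (revealed T (insert i S)) > 0" "weight \<mu> {\<xi>\<in>revealed T S. \<xi> i = 0} > 0"
  shows "norm (average \<mu> (revealed T (insert i S)) g - average \<mu> {\<xi>\<in>revealed T S. \<xi> i = 0} g) \<le> 2 * L"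
proof -
  define Z where "Z = insert i S"
  define y where "y = restrict (\<lambda>_. 1::real) Z"
  define x where "x = y(i := 0)"
  have Z: "Z \<subseteq> T" and finZ: "finite Z" using S i T(1) by (auto simp: Z_def finite_subset)
  have xy: "x \<in> cube Z" "y \<in> cube Z" "covered_by Z x y"
    using i by (auto simp: cube_def x_def y_def Z_def covered_by_def PiE_iff extensional_def)
  have X1: "revealed T (insert i S) = {\<xi>\<in>cube T. restrict \<xi> Z = y}"
    using Z by (auto simp: revealed_def y_def Z_def restrict_def fun_eq_iff)
  have X0: "{\<xi>\<in>revealed T S. \<xi> i = 0} = {\<xi>\<in>cube T. restrict \<xi> Z = x}"
    using Z i by (auto simp: revealed_def x_def y_def Z_def restrict_def fun_eq_iff split: if_splits)
  let ?P = "\<lambda>x. measure_pmf.prob \<mu> {\<xi>. restrict \<xi> Z = x}"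
  let ?E = "\<lambda>x. measure_pmf.expectation (cond_law T \<mu> Z x) (\<lambda>\<eta>. g (glue Z x \<eta>))"
  have w: "weight \<mu> {\<xi>\<in>cube T. restrict \<xi> Z = z} = ?P z" for z
    by (simp add: weighted_sum_def prob_eq_sum_cube[OF T])
  have Ppos: "?P x > 0" "?P y > 0" using pos by (simp_all only: X0 X1 w)
  have av: "average \<mu> {\<xi>\<in>cube T. restrict \<xi> Z = z} g = ?E z" if "?P z > 0" for z
    using that by (simp only: average_def w) (simp add: weighted_sum_def expectation_cond_law[OF T Z that, symmetric])
  have cov: "stoch_covered_by (T - Z) (cond_law T \<mu> Z y) (cond_law T \<mu> Z x)"
    using scp Z xy Ppos unfolding stochastic_covering_def by blast
  have "norm (?E y - ?E x) \<le> 2 * L"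
  proof (rule stoch_covered_by_expectation_diff[OF _ cov])
    fix \<eta> \<eta>' assume c: "covered_by (T - Z) \<eta> \<eta>'"
    then have "glue Z y \<eta> \<in> cube T" "glue Z x \<eta>' \<in> cube T"
      using glue_cube[OF Z] xy by (auto simp: covered_by_def)
    from lip[OF this] have "norm (g (glue Z y \<eta>) - g (glue Z x \<eta>')) \<le> L * (l1_dist_on Z y x + l1_dist_on (T - Z) \<eta> \<eta>')"
      using l1_dist_on_glue[OF T(1) Z] by metis
    also have "\<dots> \<le> L * (1 + 1)"
      using covered_by_l1_dist_le[OF finZ xy(3)] covered_by_l1_dist_le[OF _ c] T(1) L
      by (intro mult_left_mono add_mono) (auto simp: l1_dist_on_commute)
    finally show "norm (g (glue Z y \<eta>) - g (glue Z x \<eta>')) \<le> 2 * L" by simp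
  qed (use T(1) in simp)
  then show ?thesis by (simp only: X1 X0 av Ppos)
qed

text \<open>The average before revealing \<open>i\<close> is a convex combination of the averages
  given a one and given a zero at \<open>i\<close>, so the step is a fraction
  \<open>m0 / (m1 + m0)\<close> of the flip difference.\<close>

lemma average_reveal_diff:
  fixes g :: "('a \<Rightarrow> real) \<Rightarrow> 'e::euclidean_space"
  assumes T: "finite T" "set_pmf \<mu> \<subseteq> cube T" and scp: "stochastic_covering T \<mu>"
    and S: "S \<subseteq> T" and i: "i \<in> T - S"
    and lip: "\<And>x y. x \<in> cube T \<Longrightarrow> y \<in> cube T \<Longrightarrow> norm (g x - g y) \<le> L * l1_dist_on T x y"
    and L: "L \<ge> 0"
    and pos: "weight \<mu> (revealed T (insert i S)) > 0"
  shows "norm (average \<mu> (revealed T (insert i S)) g - average \<mu> (revealed T S) g) \<le> 2 * L"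
proof -
  let ?X1 = "revealed T (insert i S)" and ?X0 = "{\<xi>\<in>revealed T S. \<xi> i = 0}"
  have fin: "finite ?X1" "finite ?X0" using finite_revealed[OF T(1)] by auto
  have un: "revealed T S = ?X1 \<union> ?X0" and disj: "?X1 \<inter> ?X0 = {}"
    using i cube_01[of _ T i] by (auto simp: revealed_def)
  have split: "weighted_sum \<mu> (revealed T S) h = weighted_sum \<mu> ?X1 h + weighted_sum \<mu> ?X0 h"
    for h :: "('a \<Rightarrow> real) \<Rightarrow> 'b::real_vector"
    unfolding weighted_sum_def by (subst un) (rule sum.union_disjoint[OF fin disj])
  define m1 m0 where "m1 = weight \<mu> ?X1" and "m0 = weight \<mu> ?X0"
  have m: "m1 > 0" "m0 \<ge> 0" "m1 + m0 > 0" using pos weight_nonneg[of \<mu> ?X0] by (auto simp: m1_def m0_def)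
  let ?a1 = "average \<mu> ?X1 g" and ?a0 = "average \<mu> ?X0 g"
  have "(m1 + m0) *\<^sub>R average \<mu> (revealed T S) g = m1 *\<^sub>R ?a1 + m0 *\<^sub>R ?a0"
    unfolding average_def[of \<mu> "revealed T S"] split
    using m(3) weighted_sum_eq_average[OF fin(1), of \<mu> g] weighted_sum_eq_average[OF fin(2), of \<mu> g]
    by (simp add: m1_def[symmetric] m0_def[symmetric])
  then have "(m1 + m0) *\<^sub>R (?a1 - average \<mu> (revealed T S) g) = m0 *\<^sub>R (?a1 - ?a0)"
    by (simp add: scaleR_diff_right scaleR_left_distrib)
  then have "norm ((m1 + m0) *\<^sub>R (?a1 - average \<mu> (revealed T S) g)) = norm (m0 *\<^sub>R (?a1 - ?a0))" by simp
  then have "(m1 + m0) * norm (?a1 - average \<mu> (revealed T S) g) = m0 * norm (?a1 - ?a0)" using m by simp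
  also have "\<dots> \<le> m0 * (2 * L)"
  \<comment> \<open>If a zero at \<open>i\<close> has weight 0, the flip estimate does not apply,
    but both sides are 0.\<close>
  proof (cases "m0 = 0")
    case False
    then have "m0 > 0" using m by simp
    then show ?thesis
      using average_flip_diff[OF T scp S i lip L pos] m(2) by (intro mult_left_mono) (auto simp: m0_def)
  qed simp
  also have "\<dots> \<le> (m1 + m0) * (2 * L)" using m L by (intro mult_right_mono) auto
  finally show ?thesis using m(3) by simp
qed

lemma average_apply: "blinfun_apply (average \<mu> X F) v = average \<mu> X (\<lambda>\<xi>. blinfun_apply (F \<xi>) v)"
  by (simp add: average_def weighted_sum_def blinfun.scaleR_left blinfun.sum_left)

text \<open>For fixed \<open>v\<close> the map sending \<open>\<xi>\<close> to
  \<open>F \<xi> v\<close> is Lipschitz with constant \<open>norm v\<close>, so the vector estimate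
  with \<open>L = norm v\<close> bounds the operator norm.\<close>

lemma average_reveal_diff_blinfun:
  fixes F :: "('a \<Rightarrow> real) \<Rightarrow> 'e::euclidean_space \<Rightarrow>\<^sub>L 'e"
  assumes T: "finite T" "set_pmf \<mu> \<subseteq> cube T" and scp: "stochastic_covering T \<mu>"
    and S: "S \<subseteq> T" and i: "i \<in> T - S"
    and lip: "\<And>x y. x \<in> cube T \<Longrightarrow> y \<in> cube T \<Longrightarrow> norm (F x - F y) \<le> l1_dist_on T x y"
    and pos: "weight \<mu> (revealed T (insert i S)) > 0"
  shows "norm (average \<mu> (revealed T (insert i S)) F - average \<mu> (revealed T S) F) \<le> 2"
proof (rule norm_blinfun_bound)
  fix v
  have "norm (F x v - F y v) \<le> norm v * l1_dist_on T x y" if "x \<in> cube T" "y \<in> cube T" for x y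
  proof -
    have "norm (F x v - F y v) \<le> norm (F x - F y) * norm v"
      using norm_blinfun[of "F x - F y" v] by (simp add: blinfun.diff_left)
    also have "\<dots> \<le> l1_dist_on T x y * norm v" by (intro mult_right_mono lip that) simp
    finally show ?thesis by (simp add: mult.commute)
  qed
  from average_reveal_diff[OF T scp S i this _ pos]
  show "norm ((average \<mu> (revealed T (insert i S)) F - average \<mu> (revealed T S) F) v) \<le> 2 * norm v"
    by (simp add: blinfun.diff_left average_apply)
qed simp

section \<open>The martingale under homogeneity\<close>

lemma homogeneous_sum:
  assumes "homogeneous T k \<mu>" "\<xi> \<in> set_pmf \<mu>"
  shows "(\<Sum>i\<in>T. \<xi> i) = real k"
proof -
  have "AE \<xi> in measure_pmf \<mu>. \<xi> \<in> {\<xi>. (\<Sum>i\<in>T. \<xi> i) = real k}"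
    using assms(1) unfolding homogeneous_def by (subst (asm) measure_pmf.prob_eq_1) auto
  then show ?thesis using assms(2) by (simp add: AE_measure_pmf_iff)
qed

lemma homogeneous_sum_unrevealed:
  assumes "finite T" "homogeneous T k \<mu>" "S \<subseteq> T" "\<xi> \<in> revealed T S" "\<xi> \<in> set_pmf \<mu>"
  shows "(\<Sum>i\<in>T - S. \<xi> i) = real k - real (card S)"
proof -
  have "(\<Sum>i\<in>T. \<xi> i) = (\<Sum>i\<in>T - S. \<xi> i) + (\<Sum>i\<in>S. \<xi> i)" using assms by (simp add: sum.subset_diff)
  moreover have "(\<Sum>i\<in>S. \<xi> i) = real (card S)" using assms(4) by (simp add: revealed_def)
  ultimately show ?thesis using homogeneous_sum[OF assms(2,5)] by simp
qed

text \<open>Double counting: a point of positive mass in \<open>revealed T S\<close> has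
  \<open>k - card S\<close> ones outside \<open>S\<close> and so lies in that many of the sets on
  the left. This is total expectation for a uniformly chosen next one.\<close>

lemma weighted_sum_reveal:
  fixes g :: "('a \<Rightarrow> real) \<Rightarrow> 'e::real_vector"
  assumes T: "finite T" and hom: "homogeneous T k \<mu>" and S: "S \<subseteq> T"
  shows "(\<Sum>i\<in>T - S. weighted_sum \<mu> (revealed T (insert i S)) g)
     = (real k - real (card S)) *\<^sub>R weighted_sum \<mu> (revealed T S) g"
proof -
  \<comment> \<open>On \<open>revealed T S\<close> the coordinate \<open>\<xi> i\<close> is itself
    the indicator of \<open>revealed T (insert i S)\<close>.\<close>
  have "weighted_sum \<mu> (revealed T (insert i S)) g = (\<Sum>\<xi>\<in>revealed T S. \<xi> i *\<^sub>R pmf \<mu> \<xi> *\<^sub>R g \<xi>)"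
    if i: "i \<in> T - S" for i
    unfolding weighted_sum_def
  proof (rule sum.mono_neutral_cong_left)
    show "\<forall>\<xi>\<in>revealed T S - revealed T (insert i S). \<xi> i *\<^sub>R pmf \<mu> \<xi> *\<^sub>R g \<xi> = 0"
      using i cube_01[of _ T i] by (auto simp: revealed_def)
  qed (auto simp: revealed_def finite_revealed[OF T, unfolded revealed_def])
  then have "(\<Sum>i\<in>T - S. weighted_sum \<mu> (revealed T (insert i S)) g)
      = (\<Sum>\<xi>\<in>revealed T S. (\<Sum>i\<in>T - S. \<xi> i) *\<^sub>R pmf \<mu> \<xi> *\<^sub>R g \<xi>)"
    by (simp add: sum.swap[of _ "revealed T S"] sum_distrib_right scaleR_sum_left)
  also have "\<dots> = (\<Sum>\<xi>\<in>revealed T S. (real k - real (card S)) *\<^sub>R pmf \<mu> \<xi> *\<^sub>R g \<xi>)"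
  proof (rule sum.cong[OF refl])
    fix \<xi> assume "\<xi> \<in> revealed T S"
    then show "(\<Sum>i\<in>T - S. \<xi> i) *\<^sub>R pmf \<mu> \<xi> *\<^sub>R g \<xi> = (real k - real (card S)) *\<^sub>R pmf \<mu> \<xi> *\<^sub>R g \<xi>"
      using homogeneous_sum_unrevealed[OF T hom S] by (cases "\<xi> \<in> set_pmf \<mu>") (auto simp: set_pmf_iff)
  qed
  finally show ?thesis by (simp add: weighted_sum_def scaleR_sum_right)
qed

text \<open>Once \<open>k\<close> ones are known, homogeneity leaves mass only on the indicator of
  \<open>S\<close>.\<close>

lemma weighted_sum_all_revealed:
  assumes T: "finite T" and hom: "homogeneous T k \<mu>" and S: "S \<subseteq> T" "card S = k"
  shows "weighted_sum \<mu> (revealed T S) g = pmf \<mu> (restrict (indicator S) T) *\<^sub>R g (restrict (indicator S) T)"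
proof -
  let ?e = "restrict (indicator S) T :: 'a \<Rightarrow> real"
  have e: "?e \<in> revealed T S" using S by (auto simp: revealed_def cube_def indicator_def)
  have "pmf \<mu> \<xi> = 0" if "\<xi> \<in> revealed T S" "\<xi> \<noteq> ?e" for \<xi>
  proof (rule ccontr)
    assume "pmf \<mu> \<xi> \<noteq> 0"
    then have "(\<Sum>i\<in>T - S. \<xi> i) = 0"
      using homogeneous_sum_unrevealed[OF T hom S(1) that(1)] S(2) by (simp add: set_pmf_iff)
    moreover have "\<xi> i \<ge> 0" if "i \<in> T - S" for i
      using cube_01[of \<xi> T i] \<open>\<xi> \<in> revealed T S\<close> that by (auto simp: revealed_def)
    ultimately have "\<forall>i\<in>T - S. \<xi> i = 0" using T by (subst (asm) sum_nonneg_eq_0_iff) auto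
    then have "\<xi> = ?e" using that(1) by (auto simp: revealed_def cube_def PiE_iff extensional_def fun_eq_iff indicator_def)
    then show False using that(2) by simp
  qed
  then have "weighted_sum \<mu> (revealed T S) g = (\<Sum>\<xi>\<in>{?e}. pmf \<mu> \<xi> *\<^sub>R g \<xi>)"
    unfolding weighted_sum_def using e finite_revealed[OF T] by (intro sum.mono_neutral_right) auto
  then show ?thesis by simp
qed

text \<open>Induction on the number \<open>r\<close> of unrevealed ones; each reveal costs the
  factor of \<open>trexp_mean_le\<close> with \<open>c = 2\<close>. Weighting by mass instead of
  dividing by it lets the bound hold for null events as well.\<close>

lemma trexp_average_le:
  fixes F :: "('a \<Rightarrow> real) \<Rightarrow> 'e::euclidean_space \<Rightarrow>\<^sub>L 'e"
  assumes T: "finite T" "set_pmf \<mu> \<subseteq> cube T" and hom: "homogeneous T k \<mu>" and scp: "stochastic_covering T \<mu>"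
    and sa: "\<And>x. x \<in> cube T \<Longrightarrow> selfadjoint (F x)"
    and lip: "\<And>x y. x \<in> cube T \<Longrightarrow> y \<in> cube T \<Longrightarrow> norm (F x - F y) \<le> l1_dist_on T x y"
    and small: "\<theta>\<^sup>2 < 3 / 2"
    and S: "S \<subseteq> T" "card S + r = k"
  shows "weighted_sum \<mu> (revealed T S) (\<lambda>\<xi>. trexp \<theta> (F \<xi>))
    \<le> ((1 + 4 * \<theta>\<^sup>2 / 3) / (1 - 2 * \<theta>\<^sup>2 / 3)) ^ r * weight \<mu> (revealed T S) * trexp \<theta> (average \<mu> (revealed T S) F)"
  using S
proof (induction r arbitrary: S)
  case 0
  let ?e = "restrict (indicator S) T :: 'a \<Rightarrow> real"
  have ws: "weighted_sum \<mu> (revealed T S) g = pmf \<mu> ?e *\<^sub>R g ?e" for g :: "_ \<Rightarrow> 'b::real_vector"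
    using 0 by (intro weighted_sum_all_revealed[OF T(1) hom]) auto
  \<comment> \<open>With positive mass at \<open>?e\<close> the average is \<open>F ?e\<close> and
    equality holds; otherwise both sides are 0.\<close>
  show ?case by (cases "pmf \<mu> ?e = 0") (simp_all add: ws average_def)
next
  case (Suc r)
  define q where "q = (1 + 4 * \<theta>\<^sup>2 / 3) / (1 - 2 * \<theta>\<^sup>2 / 3)"
  have q: "q \<ge> 0" using small by (simp add: q_def)
  let ?X = "\<lambda>i. revealed T (insert i S)" and ?Y = "revealed T S"
  let ?m = "weight \<mu> ?Y"
  have fin: "finite (revealed T S')" for S' by (rule finite_revealed[OF T(1)])
  have finS: "finite S" using Suc.prems(1) T(1) finite_subset by blast
  \<comment> \<open>Positions that can still carry a one: the step bound requires positive weight,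
    and all other positions contribute 0 to every weighted sum.\<close>
  define I where "I = {i\<in>T - S. weight \<mu> (?X i) > 0}"
  have I: "finite I" "I \<subseteq> T - S" using T(1) by (auto simp: I_def)
  have out: "weighted_sum \<mu> (?X i) g = 0" if "i \<in> T - S - I" for i and g :: "_ \<Rightarrow> 'b::real_vector"
  proof (rule weighted_sum_weight_0[OF fin])
    have "\<not> weight \<mu> (?X i) > 0" using that unfolding I_def by blast
    then show "weight \<mu> (?X i) = 0" using weight_nonneg[of \<mu> "?X i"] by linarith
  qed
  have rev: "(\<Sum>i\<in>I. weighted_sum \<mu> (?X i) g) = real (Suc r) *\<^sub>R weighted_sum \<mu> ?Y g" for g :: "_ \<Rightarrow> 'b::real_vector"
  proof -
    have "(\<Sum>i\<in>I. weighted_sum \<mu> (?X i) g) = (\<Sum>i\<in>T - S. weighted_sum \<mu> (?X i) g)"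
      using I T(1) out by (intro sum.mono_neutral_left) auto
    also have "\<dots> = real (Suc r) *\<^sub>R weighted_sum \<mu> ?Y g"
    proof -
      have "real k - real (card S) = real (Suc r)" using Suc.prems(2) by linarith
      then show ?thesis using weighted_sum_reveal[OF T(1) hom Suc.prems(1), of g] by (simp only:)
    qed
    finally show ?thesis .
  qed
  show ?case
  proof (cases "?m = 0")
    case True
    then show ?thesis by (simp add: weighted_sum_weight_0[OF fin True])
  next
    case False
    then have m: "?m > 0" using weight_nonneg[of \<mu> ?Y] by simp
    \<comment> \<open>The conditional probability, given ones on \<open>S\<close>, that a uniform
      choice among the \<open>Suc r\<close> remaining ones falls on \<open>i\<close>.\<close>
    define w where "w i = weight \<mu> (?X i) / (real (Suc r) * ?m)" for i
    let ?B = "\<lambda>i. average \<mu> (?X i) F" and ?A = "average \<mu> ?Y F"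
    have sa_av: "selfadjoint (average \<mu> (revealed T S') F)" for S'
      unfolding average_def weighted_sum_def
      by (intro selfadjoint_scaleR selfadjoint_sum sa) (auto simp: revealed_def)
    have "(\<Sum>i\<in>I. w i *\<^sub>R ?B i) = (\<Sum>i\<in>I. weighted_sum \<mu> (?X i) F) /\<^sub>R (real (Suc r) * ?m)"
      by (simp add: w_def weighted_sum_eq_average[OF fin, of \<mu> _ F] scaleR_sum_right divide_inverse mult.commute)
    also have "\<dots> = ?A" by (simp add: rev average_def del: of_nat_Suc)
    finally have mean: "(\<Sum>i\<in>I. w i *\<^sub>R ?B i) = ?A" .
    have w1: "(\<Sum>i\<in>I. w i) = 1"
      using rev[of "\<lambda>_. 1::real"] m by (simp add: w_def sum_divide_distrib[symmetric] del: of_nat_Suc)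
    have "(\<Sum>i\<in>I. w i * trexp \<theta> (?B i)) \<le> (1 + \<theta>\<^sup>2 * 2\<^sup>2 / 3) / (1 - \<theta>\<^sup>2 * 2\<^sup>2 / 6) * trexp \<theta> ?A"
    proof (rule trexp_mean_le[OF sa_av sa_av _ w1 mean])
      show "w i \<ge> 0" if "i \<in> I" for i
        unfolding w_def using m weight_nonneg[of \<mu> "?X i"] by (intro divide_nonneg_pos mult_pos_pos) auto
      show "norm (?B i - ?A) \<le> 2" if "i \<in> I" for i
        using that by (intro average_reveal_diff_blinfun[OF T scp Suc.prems(1) _ lip]) (auto simp: I_def)
    qed (use small in simp)
    then have mean_le: "(\<Sum>i\<in>I. w i * trexp \<theta> (?B i)) \<le> q * trexp \<theta> ?A" by (simp add: q_def mult.commute)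
    have "real (Suc r) * weighted_sum \<mu> ?Y (\<lambda>\<xi>. trexp \<theta> (F \<xi>))
        = (\<Sum>i\<in>I. weighted_sum \<mu> (?X i) (\<lambda>\<xi>. trexp \<theta> (F \<xi>)))" by (simp add: rev)
    also have "\<dots> \<le> (\<Sum>i\<in>I. q ^ r * weight \<mu> (?X i) * trexp \<theta> (?B i))"
      unfolding q_def
    proof (rule sum_mono, rule Suc.IH)
      fix i assume "i \<in> I"
      then show "insert i S \<subseteq> T" "card (insert i S) + r = k"
        using I(2) Suc.prems finS by (auto simp: card_insert_if)
    qed
    also have "\<dots> = real (Suc r) * (q ^ r * ?m * (\<Sum>i\<in>I. w i * trexp \<theta> (?B i)))"
    proof -
      have "weight \<mu> (?X i) = real (Suc r) * ?m * w i" for i using m by (simp add: w_def del: of_nat_Suc)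
      then show ?thesis by (simp add: sum_distrib_left mult_ac del: of_nat_Suc)
    qed
    also have "\<dots> \<le> real (Suc r) * (q ^ r * ?m * (q * trexp \<theta> ?A))"
      using m q mean_le by (intro mult_left_mono) auto
    finally have "weighted_sum \<mu> ?Y (\<lambda>\<xi>. trexp \<theta> (F \<xi>)) \<le> q ^ r * ?m * (q * trexp \<theta> ?A)"
      by (rule mult_left_le_imp_le) simp
    then show ?thesis unfolding q_def[symmetric] by (simp add: mult_ac)
  qed
qed

subsection \<open>Complex matrices as real operators\<close>

text \<open>Regards \<open>complex^'d\<close> as a real Euclidean space of dimension
  \<open>2 * CARD('d)\<close>, so that the real spectral theory above applies.\<close>

definition mat_op :: "complex^'d^'d \<Rightarrow> (complex^'d) \<Rightarrow>\<^sub>L (complex^'d)" where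
  "mat_op M = Blinfun (\<lambda>v. M *v v)"

lemma mat_op_apply: "blinfun_apply (mat_op M) v = M *v v"
  unfolding mat_op_def by (subst bounded_linear_Blinfun_apply) auto

lemma mat_op_diff: "mat_op (A - B) = mat_op A - mat_op B"
  by (rule blinfun_eqI) (simp add: mat_op_apply blinfun.diff_left matrix_vector_mult_diff_rdistrib)

lemma linear_mat_op: "linear mat_op"
proof (rule linearI)
  show "mat_op (A + B) = mat_op A + mat_op B" for A B :: "complex^'d^'d"
    by (rule blinfun_eqI) (simp add: mat_op_apply blinfun.add_left matrix_vector_mult_add_rdistrib)
  show "mat_op (c *\<^sub>R A) = c *\<^sub>R mat_op A" for c and A :: "complex^'d^'d"
    by (rule blinfun_eqI)
      (simp add: mat_op_apply blinfun.scaleR_left vec_eq_iff matrix_vector_mult_def scaleR_sum_right)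
qed

lemma norm_mat_op: "norm (mat_op M) = op_norm M"
  by (simp add: norm_blinfun.rep_eq op_norm_def mat_op_apply[abs_def])

text \<open>The real inner product is the real part of the Hermitian form.\<close>

lemma selfadjoint_mat_op:
  fixes M :: "complex^'d^'d"
  assumes "hermitian M"
  shows "selfadjoint (mat_op M)"
  unfolding selfadjoint_def mat_op_apply
proof (intro allI)
  fix x y :: "complex^'d"
  have inner: "inner a b = Re (cnj a * b)" for a b :: complex by (simp add: inner_complex_def)
  have h: "cnj (M $ i $ j) = M $ j $ i" for i j using assms by (metis hermitian_def)
  have "(M *v x) \<bullet> y = Re (\<Sum>i\<in>UNIV. \<Sum>j\<in>UNIV. M $ j $ i * (cnj (x $ j) * y $ i))"
    unfolding inner_vec_def inner Re_sum[symmetric]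
    by (simp add: matrix_vector_mult_def cnj_sum sum_distrib_left sum_distrib_right h mult_ac del: Re_sum)
  also have "\<dots> = Re (\<Sum>j\<in>UNIV. \<Sum>i\<in>UNIV. M $ j $ i * (cnj (x $ j) * y $ i))"
    by (subst sum.swap) simp
  also have "\<dots> = x \<bullet> (M *v y)"
    unfolding inner_vec_def inner Re_sum[symmetric]
    by (simp add: matrix_vector_mult_def sum_distrib_left mult_ac del: Re_sum)
  finally show "(M *v x) \<bullet> y = x \<bullet> (M *v y)" .
qed

lemma of_real_vector_smult: "complex_of_real r *s v = r *\<^sub>R v"
  by (simp add: vec_eq_iff scaleR_conv_of_real[where 'a=complex])

lemma mat_eigenvalue_of_real: "mat_eigenvalue M (of_real r) \<longleftrightarrow> (\<exists>v. v \<noteq> 0 \<and> mat_op M v = r *\<^sub>R v)"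
  by (simp add: mat_eigenvalue_def of_real_vector_smult mat_op_apply)

text \<open>\<open>Max\<close> is attained because the set is finite and nonempty: every real
  eigenvalue occurs among the values \<open>u \<bullet> mat_op M u\<close> on an eigenbasis, and
  each of these is an eigenvalue.\<close>

lemma lambda_max_eigenvalue:
  fixes M :: "complex^'d^'d"
  assumes M: "selfadjoint (mat_op M)"
  shows "mat_eigenvalue M (of_real (lambda_max M))"
proof -
  obtain U where U: "eigenbasis (mat_op M) U" using eigenbasis_exists[OF M] .
  let ?R = "{r. mat_eigenvalue M (of_real r)}"
  have "?R \<subseteq> (\<lambda>u. u \<bullet> mat_op M u) ` U"
  proof clarify
    fix r assume "mat_eigenvalue M (of_real r)"
    then obtain v where v: "v \<noteq> 0" "mat_op M v = r *\<^sub>R v" by (auto simp: mat_eigenvalue_of_real)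
    have "(\<Sum>u\<in>U. (u \<bullet> v)\<^sup>2) \<noteq> 0" using eigenbasis_parseval[OF U, of v] v(1) by simp
    from sum.not_neutral_contains_not_neutral[OF this]
    obtain u where u: "u \<in> U" "u \<bullet> v \<noteq> 0" by auto
    then show "r \<in> (\<lambda>u. u \<bullet> mat_op M u) ` U" using eigenvalue_weight[OF M U v(2) u] by blast
  qed
  then have "finite ?R" using eigenbasis_finite[OF U] by (meson finite_imageI finite_subset)
  moreover have "?R \<noteq> {}"
  proof -
    have "U \<noteq> {}" using eigenbasis_card[OF U] by force
    then obtain u where u: "u \<in> U" by blast
    then have "u \<noteq> 0" "mat_op M u = (u \<bullet> mat_op M u) *\<^sub>R u"
      using eigenbasis_norm[OF U u] eigenbasis_eigenvector[OF U u] by auto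
    then show ?thesis using mat_eigenvalue_of_real by blast
  qed
  ultimately show ?thesis unfolding lambda_max_def using Max_in by blast
qed

text \<open>The factor 2 arises since an eigenspace over the complex numbers, spanned by \<open>v\<close> and
  \<open>\<i> v\<close>, is counted with its real dimension.\<close>

lemma trexp_ge_lambda_max:
  fixes M :: "complex^'d^'d"
  assumes M: "selfadjoint (mat_op M)"
  shows "2 * exp (\<theta> * lambda_max M) \<le> trexp \<theta> (mat_op M)"
proof -
  obtain v0 where v0: "v0 \<noteq> 0" "mat_op M v0 = lambda_max M *\<^sub>R v0"
    using lambda_max_eigenvalue[OF M] by (auto simp: mat_eigenvalue_of_real)
  define v where "v = v0 /\<^sub>R norm v0"
  have v: "norm v = 1" "mat_op M v = lambda_max M *\<^sub>R v"
    using v0 by (simp_all add: v_def blinfun.scaleR_right)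
  show ?thesis
  proof (rule trexp_ge_double_eigenvalue[OF M v])
    show "norm (\<i> *s v) = 1" using v(1) by (simp add: norm_vec_def norm_mult)
    have "mat_op M (\<i> *s v) = \<i> *s mat_op M v" by (simp add: mat_op_apply vector_scalar_commute)
    then show "mat_op M (\<i> *s v) = lambda_max M *\<^sub>R (\<i> *s v)"
      by (simp add: v(2) vec_eq_iff)
    show "v \<bullet> (\<i> *s v) = 0" by (simp add: inner_vec_def inner_complex_def)
  qed
qed

lemma weighted_sum_cube:
  fixes g :: "('a \<Rightarrow> real) \<Rightarrow> 'e::euclidean_space"
  assumes "finite T" "set_pmf \<mu> \<subseteq> cube T"
  shows "measure_pmf.expectation \<mu> g = weighted_sum \<mu> (cube T) g"
  unfolding weighted_sum_def using assms(2) by (intro integral_measure_pmf finite_cube[OF assms(1)]) blast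

lemma mat_op_expectation:
  assumes T: "finite T" "set_pmf \<mu> \<subseteq> cube T"
  shows "mat_op (mat_expectation \<mu> f) = weighted_sum \<mu> (cube T) (\<lambda>\<xi>. mat_op (f \<xi>))"
proof -
  have "mat_expectation \<mu> f = weighted_sum \<mu> (cube T) f"
    unfolding vec_eq_iff mat_expectation_def weighted_sum_cube[OF T] by (simp add: weighted_sum_def)
  then show ?thesis
    by (simp add: weighted_sum_def linear_sum[OF linear_mat_op] linear_scale[OF linear_mat_op])
qed

lemma weight_cube:
  assumes "finite T" "set_pmf \<mu> \<subseteq> cube T"
  shows "weight \<mu> (cube T) = 1"
  using weighted_sum_cube[OF assms, of "\<lambda>_. 1::real"] by simp

section \<open>Scalar estimates and the choice of the exponent\<close>

lemma reveal_factor_le_exp: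
  fixes \<theta> :: real
  assumes "0 \<le> \<theta>" "\<theta> \<le> 1/2"
  shows "(1 + 4 * \<theta>\<^sup>2 / 3) / (1 - 2 * \<theta>\<^sup>2 / 3) \<le> exp (2 * \<theta>\<^sup>2)"
proof -
  define u where "u = 2 * \<theta>\<^sup>2"
  have "\<theta>\<^sup>2 \<le> (1/2)\<^sup>2" using assms by (intro power_mono)
  then have u: "0 \<le> u" "u \<le> 1" by (simp_all add: u_def power2_eq_square)
  \<comment> \<open>The product of \<open>1 - u / 3\<close> with the quadratic Taylor polynomial
    exceeds \<open>1 + 2 * u / 3\<close> by \<open>(u^2 - u^3) / 6\<close>, hence the need for
    \<open>u \<le> 1\<close>.\<close>
  have "u * (u * u) \<le> 1 * (u * u)" using u by (intro mult_right_mono) auto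
  then have "1 + 2 * u / 3 \<le> (1 - u / 3) * (1 + u + u\<^sup>2 / 2)" by (simp add: algebra_simps power2_eq_square)
  also have "\<dots> \<le> (1 - u / 3) * exp u" using u exp_lower_Taylor_quadratic[of u] by (intro mult_left_mono) auto
  finally have "(1 + 2 * u / 3) / (1 - u / 3) \<le> exp u" using u by (simp add: divide_le_eq mult.commute)
  then show ?thesis by (simp add: u_def)
qed

text \<open>The optimal \<open>\<theta> = t / (4 k)\<close> is only admissible for \<open>t \<le> 2 k\<close>; beyond that \<open>\<theta> = 1/2\<close>
  still suffices for the claimed bound.\<close>

lemma obtain_exponent:
  fixes k t :: real
  assumes k: "k \<ge> 1" and t: "t \<ge> 0"
  obtains \<theta> where "0 \<le> \<theta>" "\<theta> \<le> 1/2"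
    "2 * k * \<theta>\<^sup>2 - \<theta> * t \<le> - (t\<^sup>2 / (8 * k + 2 * t * sqrt (2 * k)))"
proof (cases "t \<le> 2 * k")
  case True
  have "2 * k * (t / (4 * k))\<^sup>2 - t / (4 * k) * t = - (t\<^sup>2 / (8 * k))"
    using k by (simp add: field_simps power2_eq_square)
  also have "\<dots> \<le> - (t\<^sup>2 / (8 * k + 2 * t * sqrt (2 * k)))"
    using k t by (intro le_imp_neg_le divide_left_mono mult_pos_pos add_pos_nonneg) auto
  finally show thesis using that[of "t / (4 * k)"] True k t by (simp add: divide_le_eq)
next
  case False
  let ?D = "8 * k + 2 * t * sqrt (2 * k)"
  have s: "1 \<le> sqrt (2 * k)" using k by simp
  have D: "?D > 0" using k t by (intro add_pos_nonneg) auto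
  \<comment> \<open>At \<open>\<theta> = 1/2\<close> the exponent is \<open>- (t - k) / 2\<close>.
    Replacing the square root by 1 leaves a polynomial inequality that follows from
    \<open>t > 2 * k\<close>.\<close>
  have "2 * t * 1 \<le> 2 * t * sqrt (2 * k)" using s t by (intro mult_left_mono) auto
  then have "(t - k) / 2 * (8 * k + 2 * t) \<le> (t - k) / 2 * ?D"
    using False k by (intro mult_left_mono) auto
  moreover have "t\<^sup>2 \<le> (t - k) / 2 * (8 * k + 2 * t)"
  proof -
    have "k * (4 * k) \<le> k * (3 * t)" using False k by (intro mult_left_mono) auto
    moreover have "(t - k) / 2 * (8 * k + 2 * t) = t\<^sup>2 + (k * (3 * t) - k * (4 * k))"
      by (simp add: field_simps power2_eq_square)
    ultimately show ?thesis by linarith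
  qed
  ultimately have "t\<^sup>2 / ?D \<le> (t - k) / 2" using D by (simp add: divide_le_eq)
  moreover have "2 * k * (1/2)\<^sup>2 - 1/2 * t = - ((t - k) / 2)" by (simp add: power2_eq_square field_simps)
  ultimately show thesis using that[of "1/2"] by simp
qed

theorem theorem1p5:
  fixes n k :: nat
    and \<mu> :: "(nat \<Rightarrow> real) pmf"
    and f :: "(nat \<Rightarrow> real) \<Rightarrow> complex^'d^'d"
    and t :: real
  assumes "1 \<le> k" and "k \<le> n"
    and "set_pmf \<mu> \<subseteq> cube {1..n}"
    and "homogeneous {1..n} k \<mu>"
    and "stochastic_covering {1..n} \<mu>"
    and "\<And>x. x \<in> cube {1..n} \<Longrightarrow> hermitian (f x)"
    and "\<And>x y. x \<in> cube {1..n} \<Longrightarrow> y \<in> cube {1..n} \<Longrightarrow>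
           op_norm (f x - f y) \<le> l1_dist_on {1..n} x y"
    and "t \<ge> 0"
  shows "measure_pmf.prob \<mu> {x \<in> cube {1..n}. lambda_max (f x - mat_expectation \<mu> f) \<ge> t}
           \<le> real CARD('d) * exp (- (t\<^sup>2 / (8 * real k + 2 * t * sqrt (2 * real k))))"
proof -
  define T where "T = {1..n}"
  have T: "finite T" "set_pmf \<mu> \<subseteq> cube T" using assms(3) by (auto simp: T_def)
  \<comment> \<open>Centring keeps the Lipschitz bound and makes the starting average zero.\<close>
  define G where "G x = f x - mat_expectation \<mu> f" for x
  have sa: "selfadjoint (mat_op (G x))" if "x \<in> cube T" for x
    unfolding G_def mat_op_diff mat_op_expectation[OF T] weighted_sum_def
    using that assms(6)
    by (intro selfadjoint_diff selfadjoint_sum selfadjoint_scaleR selfadjoint_mat_op) (auto simp: T_def)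
  have lip: "norm (mat_op (G x) - mat_op (G y)) \<le> l1_dist_on T x y" if "x \<in> cube T" "y \<in> cube T" for x y
    using assms(7)[of x y] that by (simp add: T_def G_def mat_op_diff[symmetric] norm_mat_op)
  have all: "revealed T {} = cube T" by (simp add: revealed_def)
  have "weighted_sum \<mu> (cube T) (\<lambda>x. mat_op (G x)) = 0"
    using weight_cube[OF T]
    by (simp add: G_def mat_op_diff mat_op_expectation[OF T] weighted_sum_def scaleR_diff_right sum_subtractf
        scaleR_left.sum[symmetric])
  then have mean: "average \<mu> (cube T) (\<lambda>x. mat_op (G x)) = 0" by (simp add: average_def)
  have "1 \<le> real k" using assms(1) by simp
  from obtain_exponent[OF this assms(8)]
  obtain \<theta> where \<theta>: "0 \<le> \<theta>" "\<theta> \<le> 1/2"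
    "2 * real k * \<theta>\<^sup>2 - \<theta> * t \<le> - (t\<^sup>2 / (8 * real k + 2 * t * sqrt (2 * real k)))"
    by metis
  have "\<theta>\<^sup>2 \<le> (1/2)\<^sup>2" using \<theta> by (intro power_mono)
  then have small: "\<theta>\<^sup>2 < 3/2" by (simp add: power2_eq_square)
  let ?p = "measure_pmf.prob \<mu> {x \<in> cube T. lambda_max (G x) \<ge> t}"
  \<comment> \<open>Markov's inequality, written with finite sums. The 2 comes from
    \<open>trexp_ge_lambda_max\<close> and cancels later against the real dimension
    \<open>2 * CARD('d)\<close>.\<close>
  have "2 * exp (\<theta> * t) * ?p = (\<Sum>x\<in>{x\<in>cube T. lambda_max (G x) \<ge> t}. pmf \<mu> x * (2 * exp (\<theta> * t)))"
    using prob_eq_sum_cube[OF T, of "\<lambda>x. x \<in> cube T \<and> lambda_max (G x) \<ge> t"]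
    by (simp add: sum_distrib_left mult.commute)
  also have "\<dots> \<le> (\<Sum>x\<in>{x\<in>cube T. lambda_max (G x) \<ge> t}. pmf \<mu> x * trexp \<theta> (mat_op (G x)))"
  proof (intro sum_mono mult_left_mono)
    fix x assume x: "x \<in> {x\<in>cube T. lambda_max (G x) \<ge> t}"
    have "2 * exp (\<theta> * t) \<le> 2 * exp (\<theta> * lambda_max (G x))" using x \<theta>(1) by (simp add: mult_left_mono)
    also have "\<dots> \<le> trexp \<theta> (mat_op (G x))" using x by (intro trexp_ge_lambda_max sa) simp
    finally show "2 * exp (\<theta> * t) \<le> trexp \<theta> (mat_op (G x))" .
  qed simp
  also have "\<dots> \<le> (\<Sum>x\<in>cube T. pmf \<mu> x * trexp \<theta> (mat_op (G x)))"
    by (rule sum_mono2) (auto simp: finite_cube[OF T(1)] trexp_nonneg)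
  also have "\<dots> = weighted_sum \<mu> (revealed T {}) (\<lambda>x. trexp \<theta> (mat_op (G x)))"
    by (simp add: all weighted_sum_def)
  \<comment> \<open>The induction is used from its start: nothing revealed,
    \<open>r = k\<close>.\<close>
  also have "\<dots> \<le> ((1 + 4 * \<theta>\<^sup>2 / 3) / (1 - 2 * \<theta>\<^sup>2 / 3)) ^ k * weight \<mu> (revealed T {})
      * trexp \<theta> (average \<mu> (revealed T {}) (\<lambda>x. mat_op (G x)))"
    using assms(4,5) by (intro trexp_average_le[OF T _ _ sa lip small]) (auto simp: T_def)
  also have "\<dots> = ((1 + 4 * \<theta>\<^sup>2 / 3) / (1 - 2 * \<theta>\<^sup>2 / 3)) ^ k * (2 * real CARD('d))"
    by (simp add: all weight_cube[OF T] mean trexp_zero)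
  also have "\<dots> \<le> exp (2 * \<theta>\<^sup>2) ^ k * (2 * real CARD('d))"
    using reveal_factor_le_exp[OF \<theta>(1,2)] small by (intro mult_right_mono power_mono) auto
  also have "\<dots> = exp (\<theta> * t) * (2 * real CARD('d) * exp (2 * real k * \<theta>\<^sup>2 - \<theta> * t))"
    by (simp add: exp_of_nat_mult[symmetric] exp_diff mult_ac)
  finally have "?p \<le> real CARD('d) * exp (2 * real k * \<theta>\<^sup>2 - \<theta> * t)" by simp
  also have "\<dots> \<le> real CARD('d) * exp (- (t\<^sup>2 / (8 * real k + 2 * t * sqrt (2 * real k))))"
    using \<theta>(3) by (intro mult_left_mono) auto
  finally show ?thesis by (simp add: T_def G_def)
qed

end
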